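(* Let $d\ge2$ be a fixed integer. For $0<h<1$ let $$\nu^*=-\frac{1-h}{2}+\frac{1-h}{2}\sqrt{1+\frac{4h}{(1-h)^2}\Big(1-\Big(\frac{h}{h+1}\Big)^{d-1}\Big)}$$ and, for $1\le p\le d$, $$\lambda_p^*=\frac{h^{d-p}}{(\nu^*+1)^{d-p+1}}+\chi_p\,\frac{\nu^*-h+\big(\frac{h}{\nu^*+1}\big)^d}{\nu^*+1-h}\Big(\frac{\nu^*+1}{2h}\Big)^{p-1},$$ where $\chi_p=\frac{2h-\nu^*-1}{2h}$ for $1\le p\le d-1$ and $\chi_d=1$. Then, for $0<h\ll1$ (i.e. as $h\to0^+$), $$\nu^*=h-h^d+O(h^{d+1}),$$ and $$\lambda_p^*=h^{d-p}+O(h^{d-p+1}),\quad 1\le p\le d-1;\qquad \lambda_d^*=1-h+O(h^2).$$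
   Context: The quantities $\nu^*=\nu^*(h)$ and $\lambda_p^*=\lambda_p^*(h)$ are functions of $h$ for fixed $d$; the $O(\cdot)$ notation refers to $h\to0^+$, with constants that may depend on $d$. *)

theory Defs
  imports Complex_Main "HOL-Library.Landau_Symbols"
begin

text \<open>The three quantities are total functions of \<open>h\<close>; they are meaningful for \<open>0 < h < 1\<close> and
  \<open>1 \<le> p \<le> d\<close>, and on that range no division by zero and no truncated subtraction occurs.\<close>

definition nu_star :: "nat \<Rightarrow> real \<Rightarrow> real" where
  "nu_star d h =
     - (1 - h) / 2
     + (1 - h) / 2 * sqrt (1 + 4 * h / (1 - h)\<^sup>2 * (1 - (h / (h + 1)) ^ (d - 1)))"

definition chi :: "nat \<Rightarrow> nat \<Rightarrow> real \<Rightarrow> real" where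
  "chi d p h = (if p = d then 1 else (2 * h - nu_star d h - 1) / (2 * h))"

definition lambda_star :: "nat \<Rightarrow> nat \<Rightarrow> real \<Rightarrow> real" where
  "lambda_star d p h =
     h ^ (d - p) / (nu_star d h + 1) ^ (d - p + 1)
     + chi d p h
       * ((nu_star d h - h + (h / (nu_star d h + 1)) ^ d) / (nu_star d h + 1 - h))
       * ((nu_star d h + 1) / (2 * h)) ^ (p - 1)"

end

theory Submission
  imports Defs
begin

text \<open>
  The number \<open>\<nu>\<^sup>*\<close> is the nonnegative root of \<open>(\<nu> + 1) (h - \<nu>) = h (h / (h + 1))^(d - 1)\<close>, so
  \<open>0 \<le> \<nu>\<^sup>* \<le> h\<close> and \<open>h - \<nu>\<^sup>*\<close> is \<open>h^d\<close> times a product of inverses of quantities \<open>1 + O(h)\<close>.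
  Inserting this expansion, the numerator \<open>\<nu>\<^sup>* - h + (h / (\<nu>\<^sup>* + 1))^d\<close> is \<open>O(h^(d + 1))\<close>, because
  the terms of order \<open>d\<close> cancel. That absorbs the negative powers of \<open>h\<close> in the second summand of
  \<open>\<lambda>\<^sub>p\<^sup>*\<close>, and the main term comes from the first summand.
\<close>

section \<open>Quantities of the form \<open>1 + O(\<phi>)\<close> under products, powers and
  inverses\<close>

lemma bigo_mult_minus_one:
  fixes f g \<phi> :: "'a \<Rightarrow> real"
  assumes "(\<lambda>x. f x - 1) \<in> O[F](\<phi>)" "(\<lambda>x. g x - 1) \<in> O[F](\<phi>)" "\<phi> \<in> O[F](\<lambda>_. 1)"
  shows "(\<lambda>x. f x * g x - 1) \<in> O[F](\<phi>)"
proof -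
  \<comment> \<open>Boundedness of \<open>\<phi>\<close> makes \<open>f\<close> bounded, which
    controls the first term of \<open>f g - 1 = f (g - 1) + (f - 1)\<close>.\<close>
  have "(\<lambda>x. (f x - 1) + 1) \<in> O[F](\<lambda>_. 1)"
    by (intro sum_in_bigo landau_o.big_trans[OF assms(1,3)]) simp
  then have "(\<lambda>x. f x * (g x - 1)) \<in> O[F](\<lambda>x. 1 * \<phi> x)"
    by (intro landau_o.big.mult assms) simp
  then have "(\<lambda>x. f x * (g x - 1) + (f x - 1)) \<in> O[F](\<phi>)"
    by (intro sum_in_bigo assms) simp
  then show ?thesis
    by (simp add: algebra_simps)
qed

lemma bigo_power_minus_one:
  fixes f \<phi> :: "'a \<Rightarrow> real"
  assumes "(\<lambda>x. f x - 1) \<in> O[F](\<phi>)" "\<phi> \<in> O[F](\<lambda>_. 1)"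
  shows "(\<lambda>x. f x ^ n - 1) \<in> O[F](\<phi>)"
proof (induction n)
  case (Suc n)
  show ?case
    using bigo_mult_minus_one[OF assms(1) Suc assms(2)] by simp
qed simp

text \<open>For \<open>y \<ge> 1\<close> the difference \<open>1 / y - 1 = - (y - 1) / y\<close> is
  at most \<open>y - 1\<close> in absolute value.\<close>

lemma bigo_inverse_minus_one:
  fixes f \<phi> :: "'a \<Rightarrow> real"
  assumes "(\<lambda>x. f x - 1) \<in> O[F](\<phi>)" "eventually (\<lambda>x. f x \<ge> 1) F"
  shows "(\<lambda>x. inverse (f x) - 1) \<in> O[F](\<phi>)"
proof (rule landau_o.big_trans[OF _ assms(1)], rule bigoI[where c = 1])
  show "eventually (\<lambda>x. norm (inverse (f x) - 1) \<le> 1 * norm (f x - 1)) F"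
    using assms(2)
  proof eventually_elim
    case (elim x)
    have "inverse (f x) - 1 = - (f x - 1) / f x"
      using elim by (simp add: field_simps)
    moreover have "\<bar>f x - 1\<bar> / f x \<le> \<bar>f x - 1\<bar> / 1"
      using elim by (intro divide_left_mono) auto
    ultimately show ?case
      using elim by simp
  qed
qed

section \<open>Exact bounds and identities for \<open>nu_star\<close> on
  \<open>0 < h < 1\<close>\<close>

context
  fixes d :: nat
  assumes d: "d \<ge> 2"
begin

lemma nu_star_nonneg:
  assumes "0 < h" "h < 1"
  shows "nu_star d h \<ge> 0"
proof -
  have "(h / (h + 1)) ^ (d - 1) \<le> 1"
    using assms by (intro power_le_one) auto
  then have "1 \<le> sqrt (1 + 4 * h / (1 - h)\<^sup>2 * (1 - (h / (h + 1)) ^ (d - 1)))"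
    using assms by simp
  then have "(1 - h) / 2 * 1 \<le> (1 - h) / 2 * sqrt (1 + 4 * h / (1 - h)\<^sup>2 * (1 - (h / (h + 1)) ^ (d - 1)))"
    using assms by (intro mult_left_mono) auto
  then show ?thesis
    unfolding nu_star_def by linarith
qed

lemma nu_star_root:
  assumes "0 < h" "h < 1"
  shows "(nu_star d h + 1) * (h - nu_star d h) = h * (h / (h + 1)) ^ (d - 1)"
proof -
  define t where "t = (h / (h + 1)) ^ (d - 1)"
  define s where "s = sqrt (1 + 4 * h / (1 - h)\<^sup>2 * (1 - t))"
  have "t \<le> 1"
    unfolding t_def using assms by (intro power_le_one) auto
  then have "s\<^sup>2 = 1 + 4 * h / (1 - h)\<^sup>2 * (1 - t)"
    unfolding s_def using assms by (intro real_sqrt_pow2) simp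
  then have s: "(1 - h)\<^sup>2 * s\<^sup>2 = (1 - h)\<^sup>2 + 4 * h * (1 - t)"
    using assms by (simp add: field_simps)
  have nu: "nu_star d h = ((1 - h) * s - (1 - h)) / 2"
    unfolding nu_star_def s_def t_def by (simp add: field_simps)
  \<comment> \<open>The doubled factors are \<open>(1 + h) + (1 - h) * s\<close> and
    \<open>(1 + h) - (1 - h) * s\<close>, so their product is a difference of squares.\<close>
  have "4 * ((nu_star d h + 1) * (h - nu_star d h)) = (1 + h)\<^sup>2 - (1 - h)\<^sup>2 * s\<^sup>2"
    unfolding nu by (simp add: power2_eq_square field_simps)
  also have "\<dots> = 4 * (h * t)"
    unfolding s by (simp add: power2_eq_square algebra_simps)
  finally show ?thesis
    by (simp add: t_def)
qed

lemma nu_star_le: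
  assumes "0 < h" "h < 1"
  shows "nu_star d h \<le> h"
proof -
  have "(nu_star d h + 1) * (h - nu_star d h) \<ge> 0"
    unfolding nu_star_root[OF assms] using assms by simp
  then show ?thesis
    using nu_star_nonneg[OF assms] by (simp add: zero_le_mult_iff)
qed

text \<open>The root equation is solved for \<open>h - nu_star d h\<close>; pulling out
  \<open>h ^ d\<close> leaves only factors that are \<open>1 + O(h)\<close>.\<close>

lemma nu_star_expansion:
  assumes "0 < h" "h < 1"
  shows "nu_star d h - h = - (h ^ d * (inverse (1 + h) ^ (d - 1) * inverse (nu_star d h + 1)))"
proof -
  have "h * (h / (h + 1)) ^ (d - 1) = h ^ d * inverse (1 + h) ^ (d - 1)"
    using d by (cases d) (simp_all add: divide_inverse power_mult_distrib power_inverse add.commute)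
  then have "(nu_star d h + 1) * (h - nu_star d h) = h ^ d * inverse (1 + h) ^ (d - 1)"
    using nu_star_root[OF assms] by simp
  moreover have "nu_star d h + 1 > 0"
    using nu_star_nonneg[OF assms] by simp
  ultimately have "h - nu_star d h = h ^ d * inverse (1 + h) ^ (d - 1) / (nu_star d h + 1)"
    by (simp add: eq_divide_eq mult.commute)
  then show ?thesis
    by (simp add: divide_inverse mult.assoc)
qed

section \<open>Asymptotics of \<open>nu_star\<close> as \<open>h\<close> tends to 0 from the
  right\<close>

lemma eventually_small: "eventually (\<lambda>h::real. 0 < h \<and> h < 1 / 2) (at_right 0)"
  using eventually_at_right_real[of 0 "1 / 2"] by simp

lemma bigo_id_one: "(\<lambda>h::real. h) \<in> O[at_right 0](\<lambda>_. 1)"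
  by (rule bigoI[where c = 1], rule eventually_mono[OF eventually_small]) auto

lemma nu_star_bigo: "nu_star d \<in> O[at_right 0](\<lambda>h. h)"
proof (rule bigoI[where c = 1], rule eventually_mono[OF eventually_small])
  fix h :: real
  assume "0 < h \<and> h < 1 / 2"
  then show "norm (nu_star d h) \<le> 1 * norm h"
    using nu_star_nonneg[of h] nu_star_le[of h] by simp
qed

lemma inverse_nu_star_bigo:
  "(\<lambda>h. inverse (nu_star d h + 1) - 1) \<in> O[at_right 0](\<lambda>h. h)"
proof (rule bigo_inverse_minus_one)
  show "eventually (\<lambda>h. nu_star d h + 1 \<ge> 1) (at_right 0)"
    by (rule eventually_mono[OF eventually_small]) (use nu_star_nonneg in auto)
qed (use nu_star_bigo in simp)

text \<open>By \<open>nu_star_expansion\<close> the error equals \<open>- (h ^ d) * (q - 1)\<close>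
  for small positive \<open>h\<close>, where \<open>q\<close> is a product of inverses with
  \<open>q - 1 = O(h)\<close>.\<close>

lemma nu_star_asymp:
  "(\<lambda>h. nu_star d h - (h - h ^ d)) \<in> O[at_right 0](\<lambda>h. h ^ (d + 1))"
proof -
  let ?q = "\<lambda>h. inverse (1 + h) ^ (d - 1) * inverse (nu_star d h + 1)"
  have "(\<lambda>h::real. inverse (1 + h) - 1) \<in> O[at_right 0](\<lambda>h. h)"
    by (rule bigo_inverse_minus_one, simp, rule eventually_mono[OF eventually_small]) auto
  then have "(\<lambda>h. ?q h - 1) \<in> O[at_right 0](\<lambda>h. h)"
    by (intro bigo_mult_minus_one bigo_power_minus_one inverse_nu_star_bigo bigo_id_one)
  then have "(\<lambda>h. - (h ^ d) * (?q h - 1)) \<in> O[at_right 0](\<lambda>h. h ^ d * h)"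
    by (intro landau_o.big.mult) simp_all
  also have "?this \<longleftrightarrow> (\<lambda>h. nu_star d h - (h - h ^ d)) \<in> O[at_right 0](\<lambda>h. h ^ d * h)"
  proof (rule landau_o.big.in_cong, rule eventually_mono[OF eventually_small])
    fix h :: real
    assume "0 < h \<and> h < 1 / 2"
    then show "- (h ^ d) * (?q h - 1) = nu_star d h - (h - h ^ d)"
      using nu_star_expansion[of h] by (simp add: algebra_simps)
  qed
  finally show ?thesis
    by (simp add: mult.commute)
qed

section \<open>The two summands of \<open>lambda_star\<close>\<close>

lemma power_over_nu_star_bigo:
  "(\<lambda>h. h ^ m / (nu_star d h + 1) ^ n - h ^ m) \<in> O[at_right 0](\<lambda>h. h ^ (m + 1))"
proof -
  \<comment> \<open>Applied later with \<open>m = n = d\<close> in the numerator of the second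
    summand, and with \<open>m = d - p\<close>, \<open>n = d - p + 1\<close> for the main
    term.\<close>
  have "(\<lambda>h. h ^ m * (inverse (nu_star d h + 1) ^ n - 1)) \<in> O[at_right 0](\<lambda>h. h ^ m * h)"
    by (intro landau_o.big.mult bigo_power_minus_one inverse_nu_star_bigo bigo_id_one) simp
  then show ?thesis
    by (simp add: divide_inverse power_inverse algebra_simps)
qed

lemma numerator_bigo:
  "(\<lambda>h. nu_star d h - h + (h / (nu_star d h + 1)) ^ d) \<in> O[at_right 0](\<lambda>h. h ^ (d + 1))"
  using sum_in_bigo(1)[OF nu_star_asymp power_over_nu_star_bigo[of d d]]
  by (simp add: power_divide algebra_simps)

text \<open>The power contributes \<open>p - 1\<close> factors \<open>1 / h\<close>, as its base is
  at most \<open>1 / h\<close>. The factor \<open>chi\<close> costs one more, except at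
  \<open>p = d\<close>, where it is 1.\<close>

lemma chi_bound:
  assumes "0 < h" "h < 1 / 2" "1 \<le> p"
  shows "\<bar>chi d p h * ((nu_star d h + 1) / (2 * h)) ^ (p - 1)\<bar>
           \<le> (1 / h) ^ (if p = d then d - 1 else p)"
proof -
  have nu: "0 \<le> nu_star d h" "nu_star d h \<le> h"
    using nu_star_nonneg[of h] nu_star_le[of h] assms by auto
  have "(nu_star d h + 1) / (2 * h) \<le> 1 / h"
    using nu assms by (simp add: field_simps)
  then have pow: "\<bar>((nu_star d h + 1) / (2 * h)) ^ (p - 1)\<bar> \<le> (1 / h) ^ (p - 1)"
    using nu assms by (simp add: power_abs power_mono)
  have "\<bar>chi d p h\<bar> \<le> (if p = d then 1 else 1 / h)"
  proof (cases "p = d")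
    case False
    have "\<bar>(2 * h - nu_star d h - 1) / (2 * h)\<bar> = \<bar>2 * h - nu_star d h - 1\<bar> / (2 * h)"
      using assms by simp
    \<comment> \<open>The numerator is even below 1; the cruder bound 2 cancels the 2 in the
      denominator.\<close>
    also have "\<dots> \<le> 2 / (2 * h)"
      using nu assms by (intro divide_right_mono) auto
    finally show ?thesis
      using False by (simp add: chi_def)
  qed (simp add: chi_def)
  from mult_mono[OF this pow] have
    "\<bar>chi d p h * ((nu_star d h + 1) / (2 * h)) ^ (p - 1)\<bar>
       \<le> (if p = d then 1 else 1 / h) * (1 / h) ^ (p - 1)"
    using assms by (simp add: abs_mult)
  also have "\<dots> = (1 / h) ^ (if p = d then d - 1 else p)"
    using assms by (cases p) auto
  finally show ?thesis .
qed

text \<open>The numerator supplies \<open>d + 1\<close> powers of \<open>h\<close>, of which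
  \<open>chi_bound\<close> takes away at most \<open>p\<close>, or \<open>d - 1\<close> at
  \<open>p = d\<close>. That saving gives the order 2 required for
  \<open>lambda_star d d\<close>.\<close>

lemma second_summand_bigo:
  assumes "1 \<le> p" "p \<le> d"
  shows "(\<lambda>h. chi d p h
            * ((nu_star d h - h + (h / (nu_star d h + 1)) ^ d) / (nu_star d h + 1 - h))
            * ((nu_star d h + 1) / (2 * h)) ^ (p - 1))
          \<in> O[at_right 0](\<lambda>h. h ^ (if p = d then 2 else d - p + 1))"
proof -
  define k where "k = (if p = d then d - 1 else p)"
  let ?G = "\<lambda>h. nu_star d h - h + (h / (nu_star d h + 1)) ^ d"
  let ?A = "\<lambda>h. chi d p h * ((nu_star d h + 1) / (2 * h)) ^ (p - 1)"
  have A: "?A \<in> O[at_right 0](\<lambda>h. (1 / h) ^ k)"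
    by (rule bigoI[where c = 1], rule eventually_mono[OF eventually_small])
      (use chi_bound[OF _ _ assms(1)] in \<open>auto simp: k_def\<close>)
  have D: "(\<lambda>h. inverse (nu_star d h + 1 - h)) \<in> O[at_right 0](\<lambda>_. 1)"
  proof (rule bigoI[where c = 2], rule eventually_mono[OF eventually_small])
    fix h :: real
    assume h: "0 < h \<and> h < 1 / 2"
    \<comment> \<open>The bound \<open>h < 1 / 2\<close> keeps the denominator away from 0, whence
      the constant 2.\<close>
    then have "nu_star d h + 1 - h \<ge> 1 / 2"
      using nu_star_nonneg[of h] by auto
    then show "norm (inverse (nu_star d h + 1 - h)) \<le> 2 * norm (1::real)"
      by (simp add: field_simps)
  qed
  have "(\<lambda>h. ?A h * (?G h * inverse (nu_star d h + 1 - h)))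
          \<in> O[at_right 0](\<lambda>h. (1 / h) ^ k * (h ^ (d + 1) * 1))"
    by (intro landau_o.big.mult A D numerator_bigo)
  also have "(\<lambda>h::real. (1 / h) ^ k * (h ^ (d + 1) * 1))
      \<in> \<Theta>[at_right 0](\<lambda>h. h ^ (if p = d then 2 else d - p + 1))"
  proof (rule bigthetaI_cong, rule eventually_mono[OF eventually_small])
    fix h :: real
    assume h: "0 < h \<and> h < 1 / 2"
    have "d + 1 = k + (if p = d then 2 else d - p + 1)"
      using assms d by (auto simp: k_def)
    then have "h ^ (d + 1) = h ^ k * h ^ (if p = d then 2 else d - p + 1)"
      by (simp only: power_add)
    then show "(1 / h) ^ k * (h ^ (d + 1) * 1) = h ^ (if p = d then 2 else d - p + 1)"
      using h by (simp add: power_divide del: power_Suc)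
  qed
  finally show ?thesis
    by (simp only: divide_inverse mult_ac)
qed

section \<open>Asymptotics of \<open>lambda_star\<close>, with the case \<open>p = d\<close> treated
  separately\<close>

lemma lambda_star_asymp:
  assumes "1 \<le> p" "p \<le> d - 1"
  shows "(\<lambda>h. lambda_star d p h - h ^ (d - p)) \<in> O[at_right 0](\<lambda>h. h ^ (d - p + 1))"
proof -
  have p: "p \<le> d" "p \<noteq> d"
    using assms d by auto
  show ?thesis
    using sum_in_bigo(1)[OF power_over_nu_star_bigo[of "d - p" "d - p + 1"]
        second_summand_bigo[OF assms(1) p(1), unfolded if_not_P[OF p(2)]]]
    unfolding lambda_star_def by (simp only: diff_add_eq)
qed

text \<open>Since \<open>d \<ge> 2\<close>, both the term \<open>h ^ d\<close> and the error
  \<open>O(h ^ (d + 1))\<close> in \<open>nu_star_asymp\<close> are of order at least 2.\<close>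

lemma nu_star_minus_bigo: "(\<lambda>h. h - nu_star d h) \<in> O[at_right 0](\<lambda>h. h ^ 2)"
proof -
  have le: "(\<lambda>h::real. h ^ n) \<in> O[at_right 0](\<lambda>h. h ^ 2)" if "n \<ge> 2" for n
  proof (rule bigoI[where c = 1], rule eventually_mono[OF eventually_small])
    fix h :: real
    assume h: "0 < h \<and> h < 1 / 2"
    then have "h ^ n \<le> h ^ 2"
      using that by (intro power_decreasing) auto
    then show "norm (h ^ n) \<le> 1 * norm (h ^ 2)"
      using h by simp
  qed
  have "(\<lambda>h. h ^ d - (nu_star d h - (h - h ^ d))) \<in> O[at_right 0](\<lambda>h. h ^ 2)"
    by (intro sum_in_bigo landau_o.big_trans[OF nu_star_asymp] le) (use d in auto)
  then show ?thesis
    by simp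
qed

text \<open>At \<open>p = d\<close> the first summand is \<open>1 / (nu_star d h + 1)\<close>. It
  differs from \<open>1 - h\<close> by
  \<open>((h - nu_star d h) + h * nu_star d h) / (nu_star d h + 1)\<close>, where both terms of the
  numerator are \<open>O(h ^ 2)\<close>.\<close>

lemma lambda_star_asymp_last:
  "(\<lambda>h. lambda_star d d h - (1 - h)) \<in> O[at_right 0](\<lambda>h. h ^ 2)"
proof -
  have 1: "(\<lambda>h. inverse (nu_star d h + 1)) \<in> O[at_right 0](\<lambda>_. 1)"
    using sum_in_bigo(1)[OF landau_o.big_trans[OF inverse_nu_star_bigo bigo_id_one], of "\<lambda>_. 1"]
    by simp
  have "(\<lambda>h. h * nu_star d h) \<in> O[at_right 0](\<lambda>h. h ^ 2)"
    unfolding power2_eq_square by (intro landau_o.big.mult nu_star_bigo) simp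
  then have "(\<lambda>h. ((h - nu_star d h) + h * nu_star d h) * inverse (nu_star d h + 1))
      \<in> O[at_right 0](\<lambda>h. h ^ 2 * 1)"
    by (intro landau_o.big.mult sum_in_bigo nu_star_minus_bigo 1)
  also have "?this \<longleftrightarrow> (\<lambda>h. 1 / (nu_star d h + 1) - (1 - h)) \<in> O[at_right 0](\<lambda>h. h ^ 2 * 1)"
  proof (rule landau_o.big.in_cong, rule eventually_mono[OF eventually_small])
    fix h :: real
    assume "0 < h \<and> h < 1 / 2"
    then have "nu_star d h + 1 \<noteq> 0"
      using nu_star_nonneg[of h] by auto
    then show "((h - nu_star d h) + h * nu_star d h) * inverse (nu_star d h + 1)
        = 1 / (nu_star d h + 1) - (1 - h)"
      by (simp add: field_simps)
  qed
  finally have "(\<lambda>h. 1 / (nu_star d h + 1) - (1 - h)) \<in> O[at_right 0](\<lambda>h. h ^ 2)"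
    by simp
  from sum_in_bigo(1)[OF this second_summand_bigo[of d, unfolded if_P[OF refl]]] show ?thesis
    using d unfolding lambda_star_def by (simp add: diff_add_eq)
qed

end

theorem corollary1:
  fixes d :: nat
  assumes "d \<ge> 2"
  shows "(\<lambda>h. nu_star d h - (h - h ^ d)) \<in> O[at_right 0](\<lambda>h. h ^ (d + 1))
    \<and> (\<forall>p. 1 \<le> p \<and> p \<le> d - 1 \<longrightarrow>
          (\<lambda>h. lambda_star d p h - h ^ (d - p)) \<in> O[at_right 0](\<lambda>h. h ^ (d - p + 1)))
    \<and> (\<lambda>h. lambda_star d d h - (1 - h)) \<in> O[at_right 0](\<lambda>h. h ^ 2)"
  using nu_star_asymp lambda_star_asymp lambda_star_asymp_last assms by blast

end
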